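(* There are absolute constants $c>0$ and $C\ge1$ such that for all integers $n,U$ and real $\varepsilon\in(0,1/C]$ with $\min\{n,U\}\ge C/\varepsilon$, every deterministic streaming algorithm computing $\mathsf{Quantile}[n,U,\varepsilon]$ uses at least $c\,\varepsilon^{-1}\left(\log(\varepsilon U)+\log(\varepsilon n)\right)$ bits of space.
   Context: The rank of an element $u$ in a list $L$ is the number of elements of $L$ that are at most $u$. $\mathsf{Quantile}[n,U,\varepsilon]$: a stream $x_1,\dots,x_n\in[U]$ arrives; for each $1\le t\le n$, after reading $x_1,\dots,x_t$, for any query $q\in[U]$ the algorithm must output an estimate of the rank of $q$ in $(x_1,\dots,x_t)$ with additive error at most $\varepsilon t$ (deterministically, for every input and every query). A deterministic streaming algorithm using $s$ bits of space: after each prefix it is in one of at most $2^s$ memory states, the next state is an arbitrary function of the time index, current state and next symbol, and the answer to a query at time $t$ is an arbitrary function of the time index, the query and the state after reading $x_1,\dots,x_t$. (The paper's hypothesis $\min\{n,U\}\gg1/\varepsilon\gg1$ is formalized here by the constant $C$.) *)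

theory Defs
  imports Complex_Main
begin

definition list_rank :: "nat \<Rightarrow> nat list \<Rightarrow> nat" where
  "list_rank u L = length (filter (\<lambda>x. x \<le> u) L)"

text \<open>Non-uniform deterministic streaming algorithms. In \<open>next_state A t m x\<close> the symbol \<open>x\<close> is
  the one read at time \<open>t\<close> (times start at 1); in \<open>answer A t q m\<close> the state \<open>m\<close> is the one
  reached after the first \<open>t\<close> symbols. Memory states are natural numbers; since only finitely
  many states are reachable on streams of bounded length over a finite alphabet, this loses no
  generality.\<close>

record stream_alg =
  init_state :: nat
  next_state :: "nat \<Rightarrow> nat \<Rightarrow> nat \<Rightarrow> nat"
  answer :: "nat \<Rightarrow> nat \<Rightarrow> nat \<Rightarrow> real"

definition state_after :: "stream_alg \<Rightarrow> nat list \<Rightarrow> nat" where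
  "state_after A xs =
     fold (\<lambda>(t, x) m. next_state A t m x) (enumerate 1 xs) (init_state A)"

definition uses_space :: "stream_alg \<Rightarrow> nat \<Rightarrow> nat \<Rightarrow> nat \<Rightarrow> bool" where
  "uses_space A n U s \<longleftrightarrow>
     (\<exists>S. finite S \<and> card S \<le> 2 ^ s \<and>
        (\<forall>xs. set xs \<subseteq> {1..U} \<and> length xs \<le> n \<longrightarrow> state_after A xs \<in> S))"

definition computes_quantile :: "stream_alg \<Rightarrow> nat \<Rightarrow> nat \<Rightarrow> real \<Rightarrow> bool" where
  "computes_quantile A n U \<epsilon> \<longleftrightarrow>
     (\<forall>xs. length xs = n \<and> set xs \<subseteq> {1..U} \<longrightarrow>
        (\<forall>t\<in>{1..n}. \<forall>q\<in>{1..U}.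
           \<bar>answer A t q (state_after A (take t xs)) - real (list_rank q (take t xs))\<bar> \<le> \<epsilon> * real t))"

end

theory Submission
  imports Defs "HOL-Library.FuncSet"
begin

text \<open>The bound in \<open>U\<close> is a counting argument: if \<open>2 \<epsilon> k < 1\<close>, then reading the
  elements of a \<open>k\<close>-subset of \<open>[U]\<close> leaves so little error that the state determines the subset.

  For the bound in \<open>n\<close>, run \<open>k\<close> binary counters in parallel for \<open>m = n div k\<close> rounds; the state
  determines every counter up to \<open>D = 2 \<epsilon> k m\<close>. Let \<open>a\<^sub>v i\<close> be the least value of
  counter \<open>i\<close> over all inputs that reach \<open>v\<close> at the current time. Given a target vector
  \<open>X \<in> {0..M}\<^sup>k\<close>, feed the input that increments counter \<open>i\<close> exactly when \<open>a\<^sub>v i < X i\<close> at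
  the current state \<open>v\<close>. Then \<open>a\<^sub>v \<le> X\<close> forever, so at the end counter \<open>i\<close> is at most \<open>X i + D\<close>.
  Hence if \<open>2 (M + D) \<le> m\<close>, at some time at most half of the counters are incremented, that
  is, \<open>X\<close> agrees with \<open>a\<^sub>v\<close> on half of the coordinates. So \<open>X\<close> is encoded by the time, the
  state and the remaining half of its coordinates, which forces about \<open>M\<^bsup>k/2\<^esup>\<close> states.\<close>

subsection \<open>Parallel counters\<close>

definition occ :: "'a \<Rightarrow> 'a set list \<Rightarrow> nat" where
  "occ i y = length (filter (\<lambda>J. i \<in> J) y)"

lemma occ_simps [simp]:
  "occ i [] = 0" "occ i (y @ [J]) = occ i y + (if i \<in> J then 1 else 0)"
  by (simp_all add: occ_def)

text \<open>Time is an argument beside the state because only inputs of equal length in the same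
  state can be exchanged. The value depends on \<open>t\<close> and \<open>v\<close> alone, so a
  decoder that knows them can recompute it.\<close>

definition least_count :: "(nat set list \<Rightarrow> 'a) \<Rightarrow> nat \<Rightarrow> nat \<Rightarrow> 'a \<Rightarrow> nat \<Rightarrow> nat" where
  "least_count \<sigma> k t v i =
     (LEAST c. \<exists>y. length y = t \<and> set y \<subseteq> Pow {..<k} \<and> \<sigma> y = v \<and> occ i y = c)"

lemma least_count_le:
  assumes "set y \<subseteq> Pow {..<k}"
  shows "least_count \<sigma> k (length y) (\<sigma> y) i \<le> occ i y"
  unfolding least_count_def by (rule Least_le) (use assms in blast)

lemma least_count_attained:
  assumes "set y \<subseteq> Pow {..<k}"
  obtains y' where "length y' = length y" "set y' \<subseteq> Pow {..<k}" "\<sigma> y' = \<sigma> y"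
    "occ i y' = least_count \<sigma> k (length y) (\<sigma> y) i"
proof -
  have "\<exists>c. \<exists>y'. length y' = length y \<and> set y' \<subseteq> Pow {..<k} \<and> \<sigma> y' = \<sigma> y \<and> occ i y' = c"
    using assms by blast
  from LeastI_ex[OF this] show ?thesis
    using that unfolding least_count_def by blast
qed

primrec greedy :: "(nat set list \<Rightarrow> 'a) \<Rightarrow> nat \<Rightarrow> (nat \<Rightarrow> nat) \<Rightarrow> nat \<Rightarrow> nat set list" where
  "greedy \<sigma> k X 0 = []"
| "greedy \<sigma> k X (Suc t) =
     greedy \<sigma> k X t @ [{i. i < k \<and> least_count \<sigma> k t (\<sigma> (greedy \<sigma> k X t)) i < X i}]"

abbreviation unsaturated :: "(nat set list \<Rightarrow> 'a) \<Rightarrow> nat \<Rightarrow> (nat \<Rightarrow> nat) \<Rightarrow> nat \<Rightarrow> nat set" where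
  "unsaturated \<sigma> k X t \<equiv> {i. i < k \<and> least_count \<sigma> k t (\<sigma> (greedy \<sigma> k X t)) i < X i}"

lemma length_greedy [simp]: "length (greedy \<sigma> k X t) = t"
  by (induction t) auto

lemma set_greedy: "set (greedy \<sigma> k X t) \<subseteq> Pow {..<k}"
  by (induction t) auto

text \<open>Exchange the greedy input for one in the same state that attains the minimum for counter
  \<open>i\<close>. The next set contains \<open>i\<close> only if this minimum is below
  \<open>X i\<close>, so the extended exchange still counts at most \<open>X i\<close>.\<close>

lemma least_count_greedy_le:
  assumes step: "\<And>y y' J. length y = length y' \<Longrightarrow> \<sigma> y = \<sigma> y' \<Longrightarrow> \<sigma> (y @ [J]) = \<sigma> (y' @ [J])"
    and "i < k"
  shows "least_count \<sigma> k t (\<sigma> (greedy \<sigma> k X t)) i \<le> X i"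
proof (induction t)
  case 0
  show ?case using least_count_le[of "[]" k \<sigma> i] by simp
next
  case (Suc t)
  define y where "y = greedy \<sigma> k X t"
  define J where "J = unsaturated \<sigma> k X t"
  have y: "length y = t" "set y \<subseteq> Pow {..<k}" and J: "J \<subseteq> {..<k}"
    using set_greedy[of \<sigma> k X t] by (auto simp: y_def J_def)
  obtain y' where y': "length y' = t" "set y' \<subseteq> Pow {..<k}" "\<sigma> y' = \<sigma> y"
    "occ i y' = least_count \<sigma> k t (\<sigma> y) i"
    using least_count_attained[OF y(2), of \<sigma> i] y(1) by auto
  have "\<sigma> (y' @ [J]) = \<sigma> (y @ [J])"
    using step y(1) y'(1,3) by metis
  moreover have "set (y' @ [J]) \<subseteq> Pow {..<k}"
    using y'(2) J by auto
  ultimately have "least_count \<sigma> k (Suc t) (\<sigma> (y @ [J])) i \<le> occ i (y' @ [J])"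
    using least_count_le[of "y' @ [J]" k \<sigma> i] y'(1) by simp
  also have "\<dots> \<le> X i"
    using y'(4) Suc \<open>i < k\<close> by (auto simp: J_def y_def)
  finally show ?case
    by (simp add: y_def J_def)
qed

text \<open>Double counting of the increments, by counter and by round.\<close>

lemma sum_occ_greedy:
  "(\<Sum>i<k. occ i (greedy \<sigma> k X t)) = (\<Sum>r<t. card (unsaturated \<sigma> k X r))"
proof (induction t)
  case (Suc t)
  have "{..<k} \<inter> {i. Q i} = {i. i < k \<and> Q i}" for Q
    by auto
  with Suc show ?case
    by (simp add: sum.distrib sum.If_cases)
qed simp

theorem parallel_counters_states:
  fixes \<sigma> :: "nat set list \<Rightarrow> 'a" and D :: real
  assumes step: "\<And>y y' J. length y = length y' \<Longrightarrow> \<sigma> y = \<sigma> y' \<Longrightarrow> \<sigma> (y @ [J]) = \<sigma> (y' @ [J])"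
    and "finite S"
    and states: "\<And>y. set y \<subseteq> Pow {..<k} \<Longrightarrow> length y \<le> m \<Longrightarrow> \<sigma> y \<in> S"
    and accurate: "\<And>y y' i. set y \<subseteq> Pow {..<k} \<Longrightarrow> set y' \<subseteq> Pow {..<k} \<Longrightarrow> length y = m \<Longrightarrow>
        length y' = m \<Longrightarrow> \<sigma> y = \<sigma> y' \<Longrightarrow> i < k \<Longrightarrow> real (occ i y) \<le> real (occ i y') + D"
    and "2 * (real M + D) \<le> real m" and "m > 0"
  shows "(M + 1) ^ k \<le> m * card S * 2 ^ k * (M + 1) ^ (k div 2)"
proof -
  define grid where "grid = {..<k} \<rightarrow>\<^sub>E {..M}"
  \<comment> \<open>A code holds the time, the state, the set of unsaturated counters and the
    target's values on that set.\<close>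
  define codes where "codes = {..<m} \<times> S \<times>
    (SIGMA J:{J. J \<subseteq> {..<k} \<and> card J \<le> k div 2}. J \<rightarrow>\<^sub>E {..M})"
  \<comment> \<open>The value \<open>undefined\<close> matches the extensional functions in
    \<open>grid\<close>.\<close>
  define decode where "decode = (\<lambda>(t, v, J, r) i. if i \<in> J then r i
    else if i < k then least_count \<sigma> k t v i else undefined)"
  have fin_J: "finite {J. J \<subseteq> {..<k} \<and> card J \<le> k div 2}"
    by (rule finite_subset[of _ "Pow {..<k}"]) auto
  have fin_codes: "finite codes"
    unfolding codes_def using fin_J \<open>finite S\<close>
    by (intro finite_cartesian_product finite_SigmaI finite_PiE) (auto intro: finite_subset)
  have "X \<in> decode ` codes" if X: "X \<in> grid" for X
  proof -
    have X_le: "X i \<le> M" if "i < k" for i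
      using X that by (auto simp: grid_def)
    \<comment> \<open>Some input in the final state has count at most \<open>X i\<close>;
      \<open>accurate\<close> carries this over to the greedy input at the cost of
      \<open>D\<close>.\<close>
    have occ_le: "real (occ i (greedy \<sigma> k X m)) \<le> real M + D" if "i < k" for i
    proof -
      obtain y' where "length y' = m" "set y' \<subseteq> Pow {..<k}" "\<sigma> y' = \<sigma> (greedy \<sigma> k X m)"
        "occ i y' = least_count \<sigma> k m (\<sigma> (greedy \<sigma> k X m)) i"
        using least_count_attained[OF set_greedy[of \<sigma> k X m], of \<sigma> i] by auto
      with accurate[OF set_greedy[of \<sigma> k X m], of y' i] \<open>i < k\<close>
        least_count_greedy_le[of \<sigma> i k m X, OF step \<open>i < k\<close>] X_le[OF \<open>i < k\<close>]
      show ?thesis by simp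
    qed
    have "real (\<Sum>r<m. card (unsaturated \<sigma> k X r)) = (\<Sum>i<k. real (occ i (greedy \<sigma> k X m)))"
      by (simp flip: sum_occ_greedy)
    also have "\<dots> \<le> real k * (real M + D)"
      using sum_bounded_above[of "{..<k}" "\<lambda>i. real (occ i (greedy \<sigma> k X m))" "real M + D"]
        occ_le by simp
    finally have "2 * real (\<Sum>r<m. card (unsaturated \<sigma> k X r)) \<le> real k * (2 * (real M + D))"
      by (simp add: algebra_simps)
    also have "\<dots> \<le> real k * real m"
      using assms(5) by (intro mult_left_mono) auto
    finally have "real (2 * (\<Sum>r<m. card (unsaturated \<sigma> k X r))) \<le> real (k * m)"
      by (simp only: of_nat_mult of_nat_numeral)
    hence sum_le: "2 * (\<Sum>r<m. card (unsaturated \<sigma> k X r)) \<le> k * m"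
      by (simp only: of_nat_le_iff)
    have "\<exists>r<m. 2 * card (unsaturated \<sigma> k X r) \<le> k"
    proof (rule ccontr)
      assume "\<not> ?thesis"
      hence "(\<Sum>r<m. k) < (\<Sum>r<m. 2 * card (unsaturated \<sigma> k X r))"
        using \<open>m > 0\<close> by (intro sum_strict_mono) (auto simp: not_le)
      with sum_le show False
        by (simp add: sum_distrib_left mult.commute)
    qed
    then obtain t where t: "t < m" "card (unsaturated \<sigma> k X t) \<le> k div 2"
      by (auto simp: less_eq_div_iff_mult_less_eq mult.commute)
    define v where "v = \<sigma> (greedy \<sigma> k X t)"
    define J where "J = unsaturated \<sigma> k X t"
    have "(t, v, J, restrict X J) \<in> codes"
      using t X_le states[OF set_greedy[of \<sigma> k X t]]
      by (auto simp: codes_def v_def J_def)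
    \<comment> \<open>Off \<open>J\<close> the least count is not below \<open>X i\<close>, and it
      never exceeds \<open>X i\<close>, so they agree.\<close>
    moreover have "X = decode (t, v, J, restrict X J)"
    proof
      fix i
      show "X i = decode (t, v, J, restrict X J) i"
        using X least_count_greedy_le[of \<sigma> i k t X, OF step]
        by (cases "i < k") (auto simp: decode_def grid_def J_def v_def PiE_def extensional_def)
    qed
    ultimately show ?thesis
      by blast
  qed
  hence "card grid \<le> card codes"
    using fin_codes by (intro surj_card_le[of _ _ decode]) auto
  also have "card codes = m * (card S * (\<Sum>J | J \<subseteq> {..<k} \<and> card J \<le> k div 2. (M + 1) ^ card J))"
  proof -
    have "card (J \<rightarrow>\<^sub>E {..M}) = (M + 1) ^ card J \<and> finite (J \<rightarrow>\<^sub>E {..M})"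
      if "J \<subseteq> {..<k}" for J :: "nat set"
      using finite_subset[OF that] by (simp add: card_PiE finite_PiE)
    then show ?thesis
      using fin_J by (simp add: codes_def card_cartesian_product)
  qed
  also have "(\<Sum>J | J \<subseteq> {..<k} \<and> card J \<le> k div 2. (M + 1) ^ card J)
      \<le> card {J. J \<subseteq> {..<k} \<and> card J \<le> k div 2} * (M + 1) ^ (k div 2)"
    by (rule order_trans[OF sum_bounded_above[where K = "(M + 1) ^ (k div 2)"]])
      (auto intro: power_increasing)
  also have "\<dots> \<le> 2 ^ k * (M + 1) ^ (k div 2)"
  proof -
    have "card {J. J \<subseteq> {..<k} \<and> card J \<le> k div 2} \<le> card (Pow {..<k})"
      by (intro card_mono) auto
    thus ?thesis by (simp add: card_Pow)
  qed
  finally show ?thesis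
    by (simp add: grid_def card_PiE mult.assoc)
qed

subsection \<open>Quantile streams\<close>

lemma fold_enumerate_append:
  "fold f (enumerate n (xs @ ys)) m = fold f (enumerate (n + length xs) ys) (fold f (enumerate n xs) m)"
  by (simp add: enumerate_append_eq)

text \<open>Equal lengths give \<open>zs\<close> the same time indices on both sides.\<close>

lemma state_after_append_cong:
  assumes "length xs = length ys" "state_after A xs = state_after A ys"
  shows "state_after A (xs @ zs) = state_after A (ys @ zs)"
  using assms by (simp add: state_after_def fold_enumerate_append)

lemma computes_quantile_prefix:
  assumes "computes_quantile A n U \<epsilon>" "set xs \<subseteq> {1..U}" "1 \<le> length xs" "length xs \<le> n"
    "q \<in> {1..U}"
  shows "\<bar>answer A (length xs) q (state_after A xs) - real (list_rank q xs)\<bar> \<le> \<epsilon> * real (length xs)"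
proof -
  \<comment> \<open>Correctness is stated for prefixes of streams of length \<open>n\<close>;
    \<open>q\<close> is a symbol at hand for the padding.\<close>
  let ?ys = "xs @ replicate (n - length xs) q"
  have "length ?ys = n" "set ?ys \<subseteq> {1..U}" "take (length xs) ?ys = xs"
    using assms by auto
  thus ?thesis
    using assms unfolding computes_quantile_def by (metis atLeastAtMost_iff)
qed

text \<open>A shared state gives one answer, and each rank is within the permitted error of
  it.\<close>

lemma list_rank_same_state:
  assumes "computes_quantile A n U \<epsilon>" "set xs \<subseteq> {1..U}" "set ys \<subseteq> {1..U}"
    "length ys = length xs" "1 \<le> length xs" "length xs \<le> n"
    "state_after A xs = state_after A ys" "q \<in> {1..U}"
  shows "real (list_rank q xs) \<le> real (list_rank q ys) + 2 * \<epsilon> * real (length xs)"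
  using computes_quantile_prefix[OF assms(1,2,5,6,8)] computes_quantile_prefix[OF assms(1,3) _ _ assms(8)]
    assms by simp

section \<open>Subsets as streams: the bound in \<open>U\<close>\<close>

lemma list_rank_sorted_list_of_set:
  assumes "finite K"
  shows "list_rank q (sorted_list_of_set K) = card {x \<in> K. x \<le> q}"
proof -
  have "list_rank q (sorted_list_of_set K) = card (set (filter (\<lambda>x. x \<le> q) (sorted_list_of_set K)))"
    unfolding list_rank_def by (rule distinct_card[symmetric]) simp
  thus ?thesis using assms by simp
qed

text \<open>By strong induction the sets agree below \<open>q\<close>, so the two counts at
  \<open>q\<close> can differ only through membership of \<open>q\<close>.\<close>

lemma card_at_most_eq_imp_eq:
  fixes K L :: "nat set"
  assumes "finite K" "finite L" and eq: "\<And>q. q \<in> K \<union> L \<Longrightarrow> card {x \<in> K. x \<le> q} = card {x \<in> L. x \<le> q}"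
  shows "K = L"
proof -
  have "q \<in> K \<longleftrightarrow> q \<in> L" for q
  proof (induction q rule: less_induct)
    case (less q)
    hence less: "{x \<in> K. x < q} = {x \<in> L. x < q}"
      by auto
    have "card {x \<in> P. x \<le> q} = card {x \<in> P. x < q} + (if q \<in> P then 1 else 0)" if "finite P" for P
    proof -
      have "{x \<in> P. x \<le> q} = {x \<in> P. x < q} \<union> (if q \<in> P then {q} else {})"
        by (auto simp: order_le_less)
      thus ?thesis using that by (simp add: card_Un_disjoint)
    qed
    from this[OF assms(1)] this[OF assms(2)] show ?case
      using eq[of q] less by (auto split: if_splits)
  qed
  thus ?thesis by blast
qed

theorem subset_states:
  assumes A: "computes_quantile A n U \<epsilon>" "uses_space A n U s"
    and k: "0 < k" "k \<le> n" "2 * \<epsilon> * real k < 1"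
  shows "U choose k \<le> 2 ^ s"
proof -
  obtain S where S: "finite S" "card S \<le> 2 ^ s"
    "\<And>xs. set xs \<subseteq> {1..U} \<Longrightarrow> length xs \<le> n \<Longrightarrow> state_after A xs \<in> S"
    using A(2) by (auto simp: uses_space_def)
  define \<K> where "\<K> = {K. K \<subseteq> {1..U} \<and> card K = k}"
  define f where "f = (\<lambda>K. state_after A (sorted_list_of_set K))"
  have fin: "finite K" "set (sorted_list_of_set K) \<subseteq> {1..U}" "length (sorted_list_of_set K) = k"
    if "K \<in> \<K>" for K
    using that finite_subset[of K "{1..U}"] by (auto simp: \<K>_def)
  have "inj_on f \<K>"
  proof (rule inj_onI)
    fix K L assume KL: "K \<in> \<K>" "L \<in> \<K>" "f K = f L"
    show "K = L"
    proof (rule card_at_most_eq_imp_eq)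
      fix q assume "q \<in> K \<union> L"
      hence q: "q \<in> {1..U}" using KL by (auto simp: \<K>_def)
      \<comment> \<open>The total error \<open>2 * \<epsilon> * k\<close> is below 1, so the two
        integer ranks must coincide.\<close>
      have "real (card {x \<in> K. x \<le> q}) < real (card {x \<in> L. x \<le> q}) + 1"
        using list_rank_same_state[OF A(1) fin(2)[OF KL(1)] fin(2)[OF KL(2)] _ _ _ _ q] KL k fin
        by (auto simp: f_def list_rank_sorted_list_of_set)
      moreover have "real (card {x \<in> L. x \<le> q}) < real (card {x \<in> K. x \<le> q}) + 1"
        using list_rank_same_state[OF A(1) fin(2)[OF KL(2)] fin(2)[OF KL(1)] _ _ _ _ q] KL k fin
        by (auto simp: f_def list_rank_sorted_list_of_set)
      ultimately show "card {x \<in> K. x \<le> q} = card {x \<in> L. x \<le> q}"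
        by linarith
    qed (use fin KL in auto)
  qed
  moreover have "f ` \<K> \<subseteq> S"
    using S(3) fin k by (auto simp: f_def)
  ultimately have "card \<K> \<le> card S"
    using S(1) card_inj_on_le by blast
  thus ?thesis
    using S(2) n_subsets[of "{1..U}" k] by (simp add: \<K>_def)
qed

section \<open>Parallel counters as streams: the bound in \<open>n\<close>\<close>

text \<open>Each round contains exactly one of \<open>2 i + 1\<close> and \<open>2 i + 2\<close> for every \<open>i < k\<close>, so the rank
  of \<open>2 i + 1\<close> reveals counter \<open>i\<close> without interference from the other counters.\<close>

definition round_stream :: "nat \<Rightarrow> nat set \<Rightarrow> nat list" where
  "round_stream k J = map (\<lambda>i. if i \<in> J then 2 * i + 1 else 2 * i + 2) [0..<k]"

definition counter_stream :: "nat \<Rightarrow> nat set list \<Rightarrow> nat list" where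
  "counter_stream k y = concat (map (round_stream k) y)"

lemma counter_stream_snoc: "counter_stream k (y @ [J]) = counter_stream k y @ round_stream k J"
  by (simp add: counter_stream_def)

lemma length_counter_stream: "length (counter_stream k y) = k * length y"
  by (induction y) (auto simp: counter_stream_def round_stream_def)

lemma set_counter_stream: "2 * k \<le> U \<Longrightarrow> set (counter_stream k y) \<subseteq> {1..U}"
  by (auto simp: counter_stream_def round_stream_def)

lemma list_rank_append: "list_rank q (xs @ ys) = list_rank q xs + list_rank q ys"
  by (simp add: list_rank_def)

text \<open>The symbol of \<open>j < i\<close> is at most \<open>2 * i\<close>, and that of
  \<open>j > i\<close> exceeds \<open>2 * i + 1\<close>, whatever \<open>J\<close> is; only the
  symbol of \<open>i\<close> itself depends on \<open>J\<close>.\<close>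

lemma list_rank_round_stream:
  assumes "i < k"
  shows "list_rank (Suc (2 * i)) (round_stream k J) = i + (if i \<in> J then 1 else 0)"
proof -
  have "list_rank (Suc (2 * i)) (round_stream k J)
      = card {j. j < k \<and> (if j \<in> J then 2 * j + 1 else 2 * j + 2) \<le> Suc (2 * i)}"
    by (simp add: list_rank_def round_stream_def length_filter_conv_card)
      (rule arg_cong[of _ _ card], auto)
  also have "{j. j < k \<and> (if j \<in> J then 2 * j + 1 else 2 * j + 2) \<le> Suc (2 * i)}
      = {..<i} \<union> (if i \<in> J then {i} else {})"
  proof -
    have "j < i" if "2 * j + 2 \<le> Suc (2 * i)" for j :: nat
      using that by presburger
    then show ?thesis
      using assms by (auto split: if_splits simp: le_less)
  qed
  finally show ?thesis by simp
qed

lemma list_rank_counter_stream: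
  assumes "i < k"
  shows "list_rank (Suc (2 * i)) (counter_stream k y) = i * length y + occ i y"
proof (induction y rule: rev_induct)
  case Nil
  show ?case by (simp add: counter_stream_def list_rank_def)
next
  case (snoc J y)
  thus ?case
    using assms by (simp add: counter_stream_snoc list_rank_append list_rank_round_stream)
qed

theorem counter_states:
  assumes A: "computes_quantile A n U \<epsilon>" "uses_space A n U s"
    and k: "0 < k" "2 * k \<le> U" and m: "0 < m" "k * m \<le> n"
    and M: "2 * (real M + 2 * \<epsilon> * real (k * m)) \<le> real m"
  shows "(M + 1) ^ k \<le> m * 2 ^ s * 2 ^ k * (M + 1) ^ (k div 2)"
proof -
  obtain S where S: "finite S" "card S \<le> 2 ^ s"
    "\<And>xs. set xs \<subseteq> {1..U} \<Longrightarrow> length xs \<le> n \<Longrightarrow> state_after A xs \<in> S"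
    using A(2) by (auto simp: uses_space_def)
  define \<sigma> where "\<sigma> = (\<lambda>y. state_after A (counter_stream k y))"
  have "(M + 1) ^ k \<le> m * card S * 2 ^ k * (M + 1) ^ (k div 2)"
  proof (rule parallel_counters_states[where \<sigma> = \<sigma> and D = "2 * \<epsilon> * real (k * m)"])
    show "\<sigma> (y @ [J]) = \<sigma> (y' @ [J])" if "length y = length y'" "\<sigma> y = \<sigma> y'" for y y' J
      using that by (auto simp: \<sigma>_def counter_stream_snoc length_counter_stream
          intro: state_after_append_cong)
    show "\<sigma> y \<in> S" if "length y \<le> m" for y
    proof -
      have "k * length y \<le> n"
        using that m(2) by (meson le_trans mult_le_mono2)
      thus ?thesis
        unfolding \<sigma>_def by (intro S(3) set_counter_stream k) (simp add: length_counter_stream)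
    qed
    show "real (occ i y) \<le> real (occ i y') + 2 * \<epsilon> * real (k * m)"
      if "length y = m" "length y' = m" "\<sigma> y = \<sigma> y'" "i < k" for y y' i
      \<comment> \<open>The terms \<open>i * m\<close> in the two ranks cancel, leaving twice the
        error at length \<open>k * m\<close>.\<close>
      using list_rank_same_state[OF A(1) set_counter_stream[OF k(2)] set_counter_stream[OF k(2)],
          of y' y "Suc (2 * i)"] that k m
      by (simp add: length_counter_stream list_rank_counter_stream \<sigma>_def Suc_le_eq)
  qed (use S M m in auto)
  also have "\<dots> \<le> m * 2 ^ s * 2 ^ k * (M + 1) ^ (k div 2)"
    using S(2) by (intro mult_right_mono mult_left_mono) auto
  finally show ?thesis .
qed

section \<open>Choice of parameters and combination of the bounds\<close>

theorem theorem7p6: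
  "\<exists>c C :: real. c > 0 \<and> C \<ge> 1 \<and>
     (\<forall>(n :: nat) (U :: nat) (\<epsilon> :: real) (A :: stream_alg) (s :: nat).
        0 < \<epsilon> \<and> \<epsilon> \<le> 1 / C \<and> real (min n U) \<ge> C / \<epsilon> \<and>
        computes_quantile A n U \<epsilon> \<and> uses_space A n U s \<longrightarrow>
        real s \<ge> c * (1 / \<epsilon>) * (log 2 (\<epsilon> * real U) + log 2 (\<epsilon> * real n)))"
proof (rule exI[of _ "1 / 256"], rule exI[of _ 4096], intro conjI allI impI; (elim conjE)?)
  fix n U :: nat and \<epsilon> :: real and A s
  assume \<epsilon>: "0 < \<epsilon>" "\<epsilon> \<le> 1 / 4096" and nU: "real (min n U) \<ge> 4096 / \<epsilon>"
    and A: "computes_quantile A n U \<epsilon>" "uses_space A n U s"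
  \<comment> \<open>The factor 16 makes \<open>2 * \<epsilon> * k < 1\<close> for the subset bound
    and keeps the counter error \<open>D\<close> at most \<open>m / 8\<close>.\<close>
  define k where "k = nat \<lfloor>1 / (16 * \<epsilon>)\<rfloor>"
  have large: "1 / (16 * \<epsilon>) \<ge> 256"
    using \<epsilon> by (simp add: field_simps)
  have k: "real k \<le> 1 / (16 * \<epsilon>)" "real k \<ge> 1 / (16 * \<epsilon>) - 1"
    using large unfolding k_def by linarith+
  have "real k \<ge> 8"
    using k(2) large by linarith
  hence k8: "k \<ge> 8"
    by simp
  have k_le: "16 * (\<epsilon> * real k) \<le> 1"
    using k(1) \<epsilon>(1) by (simp add: field_simps)
  have "1 / (32 * \<epsilon>) = 1 / (16 * \<epsilon>) / 2"
    by simp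
  hence k_ge: "real k \<ge> 1 / (32 * \<epsilon>)"
    using k(2) large by linarith
  have "4096 / \<epsilon> \<le> real n" "4096 / \<epsilon> \<le> real U"
    using nU by auto
  hence n: "\<epsilon> * real n \<ge> 4096" and U: "\<epsilon> * real U \<ge> 4096"
    using \<epsilon>(1) by (simp_all add: pos_divide_le_eq mult.commute)
  have "\<epsilon> * (16 * real k) \<le> \<epsilon> * real n" "\<epsilon> * (16 * real k) \<le> \<epsilon> * real U"
    using k_le n U by linarith+
  hence kn: "16 * k \<le> n" and kU: "16 * k \<le> U"
    using \<epsilon>(1) by simp_all

  \<comment> \<open>Here \<epsilon> is at most \<open>1 / k\<close>, and \<open>(U / k) ^ k\<close>
    is at most the number of \<open>k\<close>-subsets.\<close>
  have "real k * log 2 (\<epsilon> * real U) \<le> real k * log 2 (real U / real k)"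
  proof -
    have "(\<epsilon> * real k) * real U \<le> 1 * real U"
      using k_le by (intro mult_right_mono) auto
    hence "\<epsilon> * real U \<le> real U / real k"
      using k8 by (simp add: field_simps)
    thus ?thesis
      using U by (intro mult_left_mono) auto
  qed
  also have "\<dots> = log 2 ((real U / real k) ^ k)"
    using k8 kU by (subst log_nat_power) auto
  also have "\<dots> \<le> log 2 (2 ^ s)"
  proof -
    have "(real U / real k) ^ k \<le> real (U choose k)"
      using binomial_ge_n_over_k_pow_k[of k U, where 'a = real] kU by simp
    also have "\<dots> \<le> 2 ^ s"
      using subset_states[OF A, of k] k8 kn k_le by (simp flip: of_nat_le_iff)
    finally show ?thesis
      by (subst log_le_cancel_iff) (use k8 kU in auto)
  qed
  finally have s1: "real k * log 2 (\<epsilon> * real U) \<le> real s"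
    by simp

  define m where "m = n div k"
  \<comment> \<open>Then \<open>2 * M\<close> takes at most half of \<open>m\<close>, and twice the
    error takes at most another quarter.\<close>
  define M where "M = m div 4"
  define L where "L = log 2 (real (M + 1))"
  have "m \<ge> 16"
    using kn k8 by (simp add: m_def less_eq_div_iff_mult_less_eq mult.commute)
  have mM: "m \<le> 4 * (M + 1)" "4 * M \<le> m"
    by (auto simp: M_def)
  \<comment> \<open>Rounding in both divisions costs at most a factor 8, which
    \<open>16 * \<epsilon> * k \<le> 1\<close> absorbs.\<close>
  have "\<epsilon> * real n \<le> real (M + 1)"
  proof -
    have "n < k * (m + 1)"
      using k8 by (simp add: m_def dividend_less_times_div)
    also have "\<dots> \<le> k * (8 * (M + 1))"
      using mM by (intro mult_left_mono) auto
    finally have "\<epsilon> * real n \<le> \<epsilon> * real (k * (8 * (M + 1)))"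
      using \<epsilon> by (intro mult_left_mono) (auto simp flip: of_nat_mult)
    also have "\<dots> = (8 * (\<epsilon> * real k)) * real (M + 1)"
      by simp
    also have "\<dots> \<le> 1 * real (M + 1)"
      using k_le by (intro mult_right_mono) auto
    finally show ?thesis by simp
  qed
  hence L: "log 2 (\<epsilon> * real n) \<le> L" and "real (M + 1) \<ge> 4096"
    using n by (auto simp: L_def)
  have "log 2 4096 \<le> L"
    using \<open>real (M + 1) \<ge> 4096\<close> unfolding L_def by (subst log_le_cancel_iff) auto
  moreover have "log 2 4096 = (12::real)"
    using log_pow_cancel[of "2::real" 12] by simp
  ultimately have L12: "L \<ge> 12"
    by simp
  have "(M + 1) ^ k \<le> m * 2 ^ s * 2 ^ k * (M + 1) ^ (k div 2)"
  proof (rule counter_states[OF A])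
    show "k * m \<le> n"
      by (simp add: m_def)
    have "(16 * (\<epsilon> * real k)) * real m \<le> 1 * real m"
      using k_le by (intro mult_right_mono) auto
    hence "16 * (\<epsilon> * real (k * m)) \<le> real m"
      by (simp add: mult.assoc)
    thus "2 * (real M + 2 * \<epsilon> * real (k * m)) \<le> real m"
      using mM(2) by simp
  qed (use k8 kU \<open>m \<ge> 16\<close> in auto)
  also have "\<dots> \<le> (4 * (M + 1)) * 2 ^ s * 2 ^ k * (M + 1) ^ (k div 2)"
    using mM by (intro mult_right_mono) auto
  finally have "real ((M + 1) ^ k) \<le> real ((4 * (M + 1)) * 2 ^ s * 2 ^ k * (M + 1) ^ (k div 2))"
    by (simp only: of_nat_le_iff)
  hence "real (M + 1) ^ k \<le> (4 * real (M + 1)) * 2 ^ s * 2 ^ k * real (M + 1) ^ (k div 2)"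
    by simp
  hence "log 2 (real (M + 1) ^ k)
      \<le> log 2 ((4 * real (M + 1)) * 2 ^ s * 2 ^ k * real (M + 1) ^ (k div 2))"
    by (subst log_le_cancel_iff) (auto intro!: mult_pos_pos)
  moreover have "log 2 4 = (2::real)"
    using log_pow_cancel[of "2::real" 2] by simp
  ultimately have "real k * L \<le> 2 + L + real s + real k + real (k div 2) * L"
    by (simp add: L_def log_mult log_nat_power del: of_nat_Suc of_nat_add)
  moreover have "real (k div 2) * L \<le> real k / 2 * L"
    using L12 by (intro mult_right_mono) auto
  \<comment> \<open>So far \<open>k * L / 2 \<le> 2 + L + s + k\<close>. With
    \<open>k \<ge> 8\<close> and \<open>L \<ge> 12\<close> the terms \<open>L\<close>,
    \<open>k\<close> and 2 are at most 1/8, 1/12 and 1/48 of \<open>k * L\<close>, together less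
    than a quarter.\<close>
  moreover have "8 * L \<le> real k * L" "real k * 12 \<le> real k * L"
    using L12 k8 by (intro mult_right_mono mult_left_mono; simp)+
  ultimately have "real k * L / 4 \<le> real s"
    using k8 by linarith
  moreover have "real k * log 2 (\<epsilon> * real n) \<le> real k * L"
    using L by (intro mult_left_mono) auto
  ultimately have s2: "real k * log 2 (\<epsilon> * real n) \<le> 4 * real s"
    by linarith

  \<comment> \<open>The two bounds add up to \<open>5 * s\<close>, rounded up to
    \<open>8 * s\<close>; the constant is 1/256 = 1/32 * 1/8.\<close>
  have "1 / (32 * \<epsilon>) * (log 2 (\<epsilon> * real U) + log 2 (\<epsilon> * real n))
      \<le> real k * (log 2 (\<epsilon> * real U) + log 2 (\<epsilon> * real n))"
    using k_ge n U by (intro mult_right_mono add_nonneg_nonneg) auto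
  also have "\<dots> \<le> 8 * real s"
    using s1 s2 by (simp add: distrib_left)
  finally show "1 / 256 * (1 / \<epsilon>) * (log 2 (\<epsilon> * real U) + log 2 (\<epsilon> * real n)) \<le> real s"
    by simp
qed auto

end
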